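(* Let $\mathcal{H}$ be a non-trivial complex Hilbert space, let $A\in\mathcal{B}(\mathcal{H})$ be a positive operator, and let $T\in \mathcal{B}_A(\mathcal{H})$. For real $\phi$ let $H^A_{\phi}=\mathrm{Re}_A(e^{i \phi} T)$. Then for any $\phi \in [0,2\pi)$, $$w^2_A(T) \leq \|H^A_\phi\|_A^2+\|H^A_{\phi+\frac{\pi}{2}}\|_A^2.$$
   Context: $\mathcal{B}(\mathcal{H})$ is the algebra of bounded linear operators on the complex Hilbert space $(\mathcal{H},\langle\cdot,\cdot\rangle)$. $A\in\mathcal{B}(\mathcal{H})$ is positive if $\langle Ax,x\rangle\ge 0$ for all $x\in\mathcal{H}$. Put $\langle x,y\rangle_A=\langle Ax,y\rangle$ and $\|x\|_A=\sqrt{\langle x,x\rangle_A}$ (a semi-norm). $\mathcal{B}_A(\mathcal{H})$ is the set of $T\in\mathcal{B}(\mathcal{H})$ that admit an $A$-adjoint, i.e. some $R\in\mathcal{B}(\mathcal{H})$ with $AR=T^*A$; equivalently $\mathcal{R}(T^*A)\subseteq\mathcal{R}(A)$, where $\mathcal{R}$ denotes range. For $T\in\mathcal{B}_A(\mathcal{H})$, $T^{\sharp_A}=A^{\dagger}T^*A$ ($A^\dagger$ the Moore–Penrose inverse of $A$) is the reduced solution of $AX=T^*A$, i.e. the unique $X\in\mathcal{B}(\mathcal{H})$ with $AX=T^*A$ and $\mathcal{R}(X)\subseteq\overline{\mathcal{R}(A)}$. For such operators, $\|T\|_A=\sup\{\|Tx\|_A/\|x\|_A : x\in\overline{\mathcal{R}(A)},\,x\ne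 0\}$ (finite). Further, $w_A(T)=\sup\{|\langle Tx,x\rangle_A|: x\in\mathcal{H},\|x\|_A=1\}$ ($A$-numerical radius), $w_A^2(T)=(w_A(T))^2$, and $\mathrm{Re}_A(T)=\frac12(T+T^{\sharp_A})$. *)

theory Defs
  imports "HOL-Analysis.Analysis"
begin

text \<open>Complex Hilbert spaces; the inner product is linear in its first argument.\<close>

class complex_inner = real_normed_vector +
  fixes scaleC :: "complex \<Rightarrow> 'a \<Rightarrow> 'a"  (infixr "*\<^sub>C" 75)
    and cinner :: "'a \<Rightarrow> 'a \<Rightarrow> complex"
  assumes scaleC_add_right: "a *\<^sub>C (x + y) = a *\<^sub>C x + a *\<^sub>C y"
    and scaleC_add_left: "(a + b) *\<^sub>C x = a *\<^sub>C x + b *\<^sub>C x"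
    and scaleC_scaleC: "a *\<^sub>C (b *\<^sub>C x) = (a * b) *\<^sub>C x"
    and scaleC_one: "1 *\<^sub>C x = x"
    and scaleR_scaleC: "r *\<^sub>R x = complex_of_real r *\<^sub>C x"
    and cinner_commute: "cinner x y = cnj (cinner y x)"
    and cinner_add_left: "cinner (x + y) z = cinner x z + cinner y z"
    and cinner_scaleC_left: "cinner (a *\<^sub>C x) y = a * cinner x y"
    and cinner_self_nonneg: "cinner x x \<in> \<real>\<^sub>\<ge>\<^sub>0"
    and cinner_self_eq_zero_iff: "cinner x x = 0 \<longleftrightarrow> x = 0"
    and norm_eq_sqrt_cinner: "norm x = sqrt (Re (cinner x x))"

class chilbert_space = complex_inner + complete_space

instantiation complex :: chilbert_space
begin

definition scaleC_complex :: "complex \<Rightarrow> complex \<Rightarrow> complex"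
  where "scaleC_complex a x = a * x"

definition cinner_complex :: "complex \<Rightarrow> complex \<Rightarrow> complex"
  where "cinner_complex x y = x * cnj y"

instance
proof
  fix x :: complex
  show "cinner x x \<in> \<real>\<^sub>\<ge>\<^sub>0"
    by (simp add: cinner_complex_def complex_mult_cnj complex_nonneg_Reals_iff)
  show "norm x = sqrt (Re (cinner x x))"
    by (simp add: cinner_complex_def complex_mult_cnj cmod_def)
qed (auto simp: scaleC_complex_def cinner_complex_def algebra_simps scaleR_conv_of_real)

end

text \<open>Operators are functions; \<open>bounded_clinear T\<close> says that \<open>T\<close> belongs to the algebra of
  bounded (complex-)linear operators.\<close>

definition bounded_clinear :: "('a::complex_inner \<Rightarrow> 'a) \<Rightarrow> bool"
  where "bounded_clinear T \<longleftrightarrow> bounded_linear T \<and> (\<forall>c x. T (c *\<^sub>C x) = c *\<^sub>C T x)"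

definition positive_op :: "('a::complex_inner \<Rightarrow> 'a) \<Rightarrow> bool"
  where "positive_op A \<longleftrightarrow> bounded_clinear A \<and> (\<forall>x. cinner (A x) x \<in> \<real>\<^sub>\<ge>\<^sub>0)"

definition cadjoint :: "('a::chilbert_space \<Rightarrow> 'a) \<Rightarrow> ('a \<Rightarrow> 'a)"
  where "cadjoint T = (THE S. bounded_clinear S \<and> (\<forall>x y. cinner (T x) y = cinner x (S y)))"

definition inner_A :: "('a::complex_inner \<Rightarrow> 'a) \<Rightarrow> 'a \<Rightarrow> 'a \<Rightarrow> complex"
  where "inner_A A x y = cinner (A x) y"

definition seminorm_A :: "('a::complex_inner \<Rightarrow> 'a) \<Rightarrow> 'a \<Rightarrow> real"
  where "seminorm_A A x = sqrt (Re (inner_A A x x))"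

definition B_A :: "('a::chilbert_space \<Rightarrow> 'a) \<Rightarrow> ('a \<Rightarrow> 'a) set"
  where "B_A A = {T. bounded_clinear T \<and> (\<exists>R. bounded_clinear R \<and> A \<circ> R = cadjoint T \<circ> A)}"

text \<open>The reduced solution of \<open>A X = T\<^sup>* A\<close>; it exists and is unique for \<open>T \<in> B_A A\<close>.\<close>

definition sharp_A :: "('a::chilbert_space \<Rightarrow> 'a) \<Rightarrow> ('a \<Rightarrow> 'a) \<Rightarrow> ('a \<Rightarrow> 'a)"
  where "sharp_A A T =
    (THE X. bounded_clinear X \<and> A \<circ> X = cadjoint T \<circ> A \<and> range X \<subseteq> closure (range A))"

text \<open>The suprema below are over sets of nonnegative reals, bounded when \<open>T \<in> B_A A\<close>.  Inserting
  \<open>0\<close> only matters for the empty set (i.e. for \<open>A = 0\<close>), where it fixes the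
  convention that the supremum is \<open>0\<close>; the library leaves \<open>Sup {}\<close> unspecified on the reals.\<close>

definition opnorm_A :: "('a::complex_inner \<Rightarrow> 'a) \<Rightarrow> ('a \<Rightarrow> 'a) \<Rightarrow> real"
  where "opnorm_A A T =
    Sup (insert 0 {seminorm_A A (T x) / seminorm_A A x | x. x \<in> closure (range A) \<and> x \<noteq> 0})"

definition numrad_A :: "('a::complex_inner \<Rightarrow> 'a) \<Rightarrow> ('a \<Rightarrow> 'a) \<Rightarrow> real"
  where "numrad_A A T =
    Sup (insert 0 {cmod (inner_A A (T x) x) | x. seminorm_A A x = 1})"

definition Re_A :: "('a::chilbert_space \<Rightarrow> 'a) \<Rightarrow> ('a \<Rightarrow> 'a) \<Rightarrow> ('a \<Rightarrow> 'a)"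
  where "Re_A A T = (\<lambda>x. (1/2) *\<^sub>C (T x + sharp_A A T x))"

definition H_A :: "('a::chilbert_space \<Rightarrow> 'a) \<Rightarrow> ('a \<Rightarrow> 'a) \<Rightarrow> real \<Rightarrow> ('a \<Rightarrow> 'a)"
  where "H_A A T \<phi> = Re_A A (\<lambda>x. exp (\<i> * complex_of_real \<phi>) *\<^sub>C T x)"

end

theory Submission
  imports Defs
begin

text \<open>Put \<open>S = e\<^sup>i\<^sup>\<phi> T\<close> and let \<open>H\<close>, \<open>K\<close> be the operators at \<open>\<phi>\<close> and \<open>\<phi> + \<pi>/2\<close>.  Since
  \<open>A S\<^sup>\<sharp> = S\<^sup>* A\<close>, the form values of \<open>H\<close> and \<open>K\<close> at \<open>x\<close> are the real part and minus the imaginary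
  part of that of \<open>S\<close>, so Cauchy--Schwarz for the semi-inner product gives
  \<open>|\<langle>T x, x\<rangle>\<^sub>A|\<^sup>2 \<le> \<parallel>H x\<parallel>\<^sub>A\<^sup>2 + \<parallel>K x\<parallel>\<^sub>A\<^sup>2\<close> when \<open>\<parallel>x\<parallel>\<^sub>A = 1\<close>.  Both operators map the kernel of
  \<open>A\<close> into itself, so \<open>x\<close> may be replaced by its projection onto the closure of the range
  of \<open>A\<close>.  That the suprema are finite follows from symmetry of \<open>H\<close> with respect to the form:
  \<open>n \<mapsto> \<parallel>H\<^sup>n x\<parallel>\<^sub>A\<close> is log-convex and grows at most like \<open>\<parallel>H\<parallel>\<^sup>n\<close>, whence \<open>\<parallel>H x\<parallel>\<^sub>A \<le> \<parallel>H\<parallel> \<parallel>x\<parallel>\<^sub>A\<close>.\<close>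

section \<open>Complex inner product spaces\<close>

lemma bounded_clinear_linear:
  assumes "bounded_clinear T"
  shows "bounded_linear T" "T (c *\<^sub>C x) = c *\<^sub>C T x" "T (x + y) = T x + T y"
    "T (x - y) = T x - T y" "T 0 = 0"
proof -
  show b: "bounded_linear T" and "T (c *\<^sub>C x) = c *\<^sub>C T x"
    using assms by (auto simp: bounded_clinear_def)
  from b interpret bounded_linear T .
  show "T (x + y) = T x + T y" "T (x - y) = T x - T y" "T 0 = 0"
    by (rule add diff zero)+
qed

lemma bounded_clinearI:
  fixes T :: "'a::complex_inner \<Rightarrow> 'a"
  assumes "\<And>x y. T (x + y) = T x + T y" "\<And>c x. T (c *\<^sub>C x) = c *\<^sub>C T x"
    "\<And>x. norm (T x) \<le> norm x * K"
  shows "bounded_clinear T"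
  unfolding bounded_clinear_def
  by (intro conjI allI bounded_linear_intro[of T K]) (auto simp: assms scaleR_scaleC)

lemma cinner_add_right: "cinner (x::'a::complex_inner) (y + z) = cinner x y + cinner x z"
  by (metis cinner_add_left cinner_commute complex_cnj_add)

lemma cinner_scaleC_right: "cinner (x::'a::complex_inner) (c *\<^sub>C y) = cnj c * cinner x y"
  by (metis cinner_scaleC_left cinner_commute complex_cnj_mult)

lemma scaleC_minus_one: "(-1) *\<^sub>C (x::'a::complex_inner) = - x"
  using scaleR_scaleC[of "-1" x] by simp

lemma cinner_minus_left: "cinner (- x) (y::'a::complex_inner) = - cinner x y"
  using cinner_scaleC_left[of "-1" x y] by (simp add: scaleC_minus_one)

lemma cinner_minus_right: "cinner x (- (y::'a::complex_inner)) = - cinner x y"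
  using cinner_scaleC_right[of x "-1" y] by (simp add: scaleC_minus_one)

lemma cinner_diff_left: "cinner (x - y) (z::'a::complex_inner) = cinner x z - cinner y z"
  using cinner_add_left[of x "- y" z] by (simp add: cinner_minus_left)

lemma cinner_diff_right: "cinner x (y - (z::'a::complex_inner)) = cinner x y - cinner x z"
  using cinner_add_right[of x y "- z"] by (simp add: cinner_minus_right)

lemma cinner_zero_left [simp]: "cinner 0 (y::'a::complex_inner) = 0"
  using cinner_diff_left[of 0 0 y] by simp

lemma cinner_zero_right [simp]: "cinner (x::'a::complex_inner) 0 = 0"
  using cinner_diff_right[of x 0 0] by simp

lemmas cinner_simps = cinner_add_left cinner_add_right cinner_scaleC_left cinner_scaleC_right
  cinner_diff_left cinner_diff_right

lemma cinner_self: "cinner x (x::'a::complex_inner) = complex_of_real ((norm x)\<^sup>2)"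
  using cinner_self_nonneg[of x] by (auto simp: norm_eq_sqrt_cinner complex_nonneg_Reals_iff complex_eq_iff)

lemma norm_scaleC: "norm (c *\<^sub>C (x::'a::complex_inner)) = cmod c * norm x"
proof -
  have "cinner (c *\<^sub>C x) (c *\<^sub>C x) = complex_of_real ((cmod c * norm x)\<^sup>2)"
    using complex_norm_square[of c] by (simp add: cinner_simps cinner_self[of x] power_mult_distrib)
  then have "(norm (c *\<^sub>C x))\<^sup>2 = (cmod c * norm x)\<^sup>2"
    unfolding cinner_self of_real_eq_iff .
  then show ?thesis
    by (rule power2_eq_imp_eq) simp_all
qed

lemma cinner_left_eqI:
  assumes "\<And>z. cinner x z = cinner y (z::'a::complex_inner)"
  shows "x = y"
  using assms[of "x - y"] cinner_self_eq_zero_iff[of "x - y"] by (simp add: cinner_diff_left)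

lemma cinner_right_eqI:
  assumes "\<And>z. cinner z x = cinner (z::'a::complex_inner) y"
  shows "x = y"
  using assms[of "x - y"] cinner_self_eq_zero_iff[of "x - y"] by (simp add: cinner_diff_right)

lemma bounded_clinear_scaleC:
  assumes "bounded_clinear T"
  shows "bounded_clinear (\<lambda>x. c *\<^sub>C T x)"
proof -
  obtain K where K: "\<And>x. norm (T x) \<le> norm x * K"
    using bounded_clinear_linear(1)[OF assms] bounded_linear.bounded by blast
  show ?thesis
  proof (rule bounded_clinearI)
    show "norm (c *\<^sub>C T x) \<le> norm x * (cmod c * K)" for x
      using mult_left_mono[OF K[of x], of "cmod c"] by (simp add: norm_scaleC ac_simps)
  qed (simp_all add: bounded_clinear_linear[OF assms] scaleC_add_right scaleC_scaleC mult.commute)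
qed

lemma bounded_clinear_add:
  assumes "bounded_clinear S" "bounded_clinear T"
  shows "bounded_clinear (\<lambda>x. S x + T x)"
  using assms by (auto simp: bounded_clinear_def bounded_linear_add scaleC_add_right)

lemma bounded_clinear_compose:
  assumes "bounded_clinear S" "bounded_clinear T"
  shows "bounded_clinear (S \<circ> T)"
  using assms by (auto simp: bounded_clinear_def bounded_linear_compose comp_def)

section \<open>Positive operators\<close>

text \<open>Makes the plain inner product an instance of the form of a positive operator, so that
  Cauchy-Schwarz for \<open>inner_A\<close> also yields the ordinary one.\<close>

lemma positive_op_id: "positive_op (id :: 'a::complex_inner \<Rightarrow> 'a)"
  by (auto simp: positive_op_def cinner_self_nonneg intro!: bounded_clinearI[of _ 1])

context
  fixes A :: "'a::complex_inner \<Rightarrow> 'a"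
  assumes A: "positive_op A"
begin

lemma positive_op_bounded_clinear: "bounded_clinear A"
  using A by (simp add: positive_op_def)

lemmas A_simps = bounded_clinear_linear(2-5)[OF positive_op_bounded_clinear]

lemma positive_op_self:
  shows "Im (cinner (A x) x) = 0" "0 \<le> Re (cinner (A x) x)"
  using A by (auto simp: positive_op_def complex_nonneg_Reals_iff)

text \<open>Polarization: since the form is real on the diagonal, its value at \<open>x + y\<close>
  relates the imaginary parts of the two mixed terms, and its value at
  \<open>x + \<i> *\<^sub>C y\<close> their real parts.\<close>

lemma positive_op_symmetric: "cinner (A x) y = cinner x (A y)"
proof -
  have "Im (cinner (A x) y) + Im (cinner (A y) x) = 0"
    using positive_op_self(1)[of "x + y"] positive_op_self(1)[of x] positive_op_self(1)[of y]
    by (simp add: A_simps cinner_simps)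
  moreover have "Re (cinner (A x) y) = Re (cinner (A y) x)"
    using positive_op_self(1)[of "x + \<i> *\<^sub>C y"] positive_op_self(1)[of x] positive_op_self(1)[of y]
    by (simp add: A_simps cinner_simps)
  ultimately have "cinner (A x) y = cnj (cinner (A y) x)"
    by (simp add: complex_eq_iff)
  then show ?thesis
    by (metis cinner_commute)
qed

text \<open>The form is nonnegative at every \<open>x - (t * b) *\<^sub>C y\<close>; a suitable
  \<open>t\<close> gives the bound. As the form may be degenerate, \<open>q = 0\<close> does not
  force \<open>y = 0\<close> and is treated separately.\<close>

lemma positive_op_Cauchy_Schwarz:
  "(cmod (cinner (A x) y))\<^sup>2 \<le> Re (cinner (A x) x) * Re (cinner (A y) y)"
proof -
  define b where "b = cinner (A x) y"
  define p where "p = Re (cinner (A x) x)"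
  define q where "q = Re (cinner (A y) y)"
  have b': "cinner (A y) x = cnj b"
    unfolding b_def by (metis cinner_commute positive_op_symmetric)
  have q0: "0 \<le> q" unfolding q_def by (rule positive_op_self)
  have p0: "0 \<le> p" unfolding p_def by (rule positive_op_self)
  have quad: "0 \<le> p - 2 * t * (cmod b)\<^sup>2 + t\<^sup>2 * (cmod b)\<^sup>2 * q" for t :: real
  proof -
    \<comment> \<open>The factor \<open>b\<close> turns both cross terms into the same real number,
      \<open>- t * (cmod b)\<^sup>2\<close>.\<close>
    define s where "s = - complex_of_real t * b"
    have eq: "cinner (A (x + s *\<^sub>C y)) (x + s *\<^sub>C y)
        = cinner (A x) x + (cnj s * b + s * cnj b) + (s * cnj s) * cinner (A y) y"
      by (simp add: A_simps cinner_simps b' b_def[symmetric] algebra_simps)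
    have quadratic: "s * cnj s = complex_of_real (t\<^sup>2 * (cmod b)\<^sup>2)"
      using complex_norm_square[of b] by (simp add: s_def power2_eq_square)
    have linear: "cnj s * b + s * cnj b = complex_of_real (- 2 * t * (cmod b)\<^sup>2)"
      using complex_norm_square[of b] by (simp add: s_def mult.commute)
    have Re: "Re (u + complex_of_real c + complex_of_real d * v) = Re u + c + d * Re v" for u v c d
      by simp
    have "Re (cinner (A (x + s *\<^sub>C y)) (x + s *\<^sub>C y))
        = p + (- 2 * t * (cmod b)\<^sup>2) + t\<^sup>2 * (cmod b)\<^sup>2 * q"
      unfolding eq quadratic linear Re p_def q_def ..
    then show ?thesis
      using positive_op_self(2)[of "x + s *\<^sub>C y"] by simp
  qed
  have "(cmod b)\<^sup>2 \<le> p * q"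
  proof (cases "q = 0")
    case True
    show ?thesis
    proof (cases "b = 0")
      \<comment> \<open>With \<open>q = 0\<close> the quadratic is affine in \<open>t\<close>; at
        the chosen \<open>t\<close> it equals -1, which is absurd.\<close>
      case False
      then show ?thesis
        using quad[of "(p + 1) / (2 * (cmod b)\<^sup>2)"] p0 True by (simp add: field_simps)
    qed (simp add: True)
  next
    case False
    \<comment> \<open>For \<open>b \<noteq> 0\<close> the quadratic is smallest at
      \<open>t = 1 / q\<close>.\<close>
    then have "0 \<le> p - (cmod b)\<^sup>2 / q"
      using quad[of "1 / q"] by (simp add: power2_eq_square field_simps)
    then show ?thesis
      using False q0 by (simp add: field_simps)
  qed
  then show ?thesis
    by (simp add: b_def p_def q_def)
qed

lemma seminorm_A_nonneg: "0 \<le> seminorm_A A x"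
  by (simp add: seminorm_A_def inner_A_def positive_op_self)

lemma seminorm_A_squared: "(seminorm_A A x)\<^sup>2 = Re (cinner (A x) x)"
  by (simp add: seminorm_A_def inner_A_def positive_op_self)

lemma inner_A_le_seminorm: "cmod (cinner (A x) y) \<le> seminorm_A A x * seminorm_A A y"
  by (rule power2_le_imp_le)
    (simp_all add: power_mult_distrib seminorm_A_squared seminorm_A_nonneg positive_op_Cauchy_Schwarz)

end

section \<open>Comparison of the semi-norm with the norm, and boundedness of form-symmetric
  operators\<close>

lemma norm_cinner_le: "cmod (cinner x y) \<le> norm x * norm (y::'a::complex_inner)"
  using inner_A_le_seminorm[OF positive_op_id, of x y]
  by (simp add: seminorm_A_def inner_A_def norm_eq_sqrt_cinner)

lemma seminorm_A_le_norm:
  assumes A: "positive_op (A :: 'a::complex_inner \<Rightarrow> 'a)"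
  obtains M where "0 \<le> M" "\<And>x. seminorm_A A x \<le> M * norm x"
proof -
  obtain K where K: "0 \<le> K" "\<And>x. norm (A x) \<le> norm x * K"
    using bounded_linear.nonneg_bounded[OF bounded_clinear_linear(1)[OF positive_op_bounded_clinear[OF A]]]
    by blast
  have "seminorm_A A x \<le> sqrt K * norm x" for x
  proof (rule power2_le_imp_le)
    have "Re (cinner (A x) x) \<le> norm (A x) * norm x"
      using norm_cinner_le[of "A x" x] complex_Re_le_cmod order_trans by blast
    also have "\<dots> \<le> K * (norm x)\<^sup>2"
      using mult_right_mono[OF K(2)[of x], of "norm x"] by (simp add: power2_eq_square ac_simps)
    finally show "(seminorm_A A x)\<^sup>2 \<le> (sqrt K * norm x)\<^sup>2"
      by (simp add: seminorm_A_squared[OF A] power_mult_distrib K)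
  qed (use K in auto)
  then show ?thesis
    using that[of "sqrt K"] K by simp
qed

text \<open>Log-convexity \<open>\<parallel>H\<^sup>n\<^sup>+\<^sup>1x\<parallel>\<^sup>2 \<le> \<parallel>H\<^sup>nx\<parallel> \<parallel>H\<^sup>n\<^sup>+\<^sup>2x\<parallel>\<close> of the orbit forces its growth rate to be at least
  \<open>\<parallel>Hx\<parallel>/\<parallel>x\<parallel>\<close> in the semi-norm, while boundedness of \<open>A\<close> and \<open>H\<close> limits that rate by the operator norm.\<close>

lemma A_symmetric_bounded:
  assumes A: "positive_op (A :: 'a::complex_inner \<Rightarrow> 'a)"
    and H: "bounded_linear H"
    and sym: "\<And>x y. cinner (A (H x)) y = cinner (A x) (H y)"
  obtains K where "0 \<le> K" "\<And>x. seminorm_A A (H x) \<le> K * seminorm_A A x"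
proof -
  obtain K where K: "0 < K" "\<And>x. norm (H x) \<le> norm x * K"
    using bounded_linear.pos_bounded[OF H] by blast
  obtain M where M: "0 \<le> M" "\<And>x. seminorm_A A x \<le> M * norm x"
    using seminorm_A_le_norm[OF A] by blast
  have "seminorm_A A (H x) \<le> K * seminorm_A A x" for x
  proof -
    define f where "f n = seminorm_A A ((H ^^ n) x)" for n
    have f0: "0 \<le> f n" for n by (simp add: f_def seminorm_A_nonneg[OF A])
    have conv: "(f (Suc n))\<^sup>2 \<le> f n * f (Suc (Suc n))" for n
    proof -
      \<comment> \<open>Symmetry moves one factor \<open>H\<close> from the left to the right
        argument of the form, then Cauchy-Schwarz applies.\<close>
      have "(f (Suc n))\<^sup>2 = Re (cinner (A ((H ^^ n) x)) ((H ^^ Suc (Suc n)) x))"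
        by (simp add: f_def seminorm_A_squared[OF A] sym)
      also have "\<dots> \<le> f n * f (Suc (Suc n))"
        unfolding f_def using inner_A_le_seminorm[OF A] complex_Re_le_cmod order_trans by blast
      finally show ?thesis .
    qed
    \<comment> \<open>The ratios \<open>f (Suc n) / f n\<close> never drop below
      \<open>f 1 / f 0\<close>; denominators are cleared because \<open>f\<close> may
      vanish.\<close>
    have step: "f 1 * f n \<le> f 0 * f (Suc n)" for n
    proof (induction n)
      case (Suc n)
      show ?case
      proof (cases "f (Suc n) = 0")
        case False
        then have p: "0 < f (Suc n)" using f0[of "Suc n"] by simp
        have "f (Suc n) * (f 1 * f (Suc n)) = f 1 * (f (Suc n))\<^sup>2"
          by (simp add: power2_eq_square)
        also have "\<dots> \<le> f 1 * (f n * f (Suc (Suc n)))"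
          by (intro mult_left_mono conv f0)
        also have "\<dots> = (f 1 * f n) * f (Suc (Suc n))" by simp
        also have "\<dots> \<le> (f 0 * f (Suc n)) * f (Suc (Suc n))"
          by (intro mult_right_mono Suc f0)
        finally have "f (Suc n) * (f 1 * f (Suc n)) \<le> f (Suc n) * (f 0 * f (Suc (Suc n)))"
          by (simp add: ac_simps)
        then show ?thesis using p by simp
      qed (simp add: f0)
    qed simp
    have bnd: "f n \<le> M * norm x * K ^ n" for n
    proof -
      have "norm ((H ^^ n) x) \<le> norm x * K ^ n"
      proof (induction n)
        case (Suc n)
        have "norm ((H ^^ Suc n) x) \<le> norm ((H ^^ n) x) * K" by (simp add: K)
        also have "\<dots> \<le> norm x * K ^ n * K"
          using Suc K(1) by (intro mult_right_mono) auto
        finally show ?case by (simp add: ac_simps)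
      qed simp
      then show ?thesis
        unfolding f_def using M(2)[of "(H ^^ n) x"] mult_left_mono[OF _ M(1)]
        by (smt (verit) mult.assoc)
    qed
    have "f 1 \<le> K * f 0"
    proof (cases "f 0 = 0")
      case True
      then show ?thesis using conv[of 0] by simp
    next
      case False
      then have p: "0 < f 0" using f0[of 0] by simp
      have pow: "(f 1 / f 0) ^ n * f 0 \<le> f n" for n
      proof (induction n)
        case (Suc n)
        have "(f 1 / f 0) ^ Suc n * f 0 = (f 1 / f 0) * ((f 1 / f 0) ^ n * f 0)" by simp
        also have "\<dots> \<le> (f 1 / f 0) * f n"
          using f0 by (intro mult_left_mono Suc) auto
        also have "\<dots> \<le> f (Suc n)" using step[of n] p by (simp add: field_simps)
        finally show ?case .
      qed simp
      show ?thesis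
      \<comment> \<open>A ratio \<open>f 1 / f 0\<close> above \<open>K\<close> would make its
        powers divided by \<open>K ^ n\<close> unbounded, while \<open>pow\<close> and
        \<open>bnd\<close> keep them below a constant independent of \<open>n\<close>.\<close>
      proof (rule ccontr)
        assume "\<not> ?thesis"
        then have r: "1 < f 1 / f 0 / K" using p K(1) by (simp add: field_simps)
        obtain n where n: "M * norm x / f 0 < (f 1 / f 0 / K) ^ n"
          using real_arch_pow[OF r] by blast
        have "(f 1 / f 0) ^ n * f 0 \<le> M * norm x * K ^ n"
          using pow bnd order_trans by blast
        then have "(f 1 / f 0 / K) ^ n \<le> M * norm x / f 0"
          using p K(1) by (simp add: power_divide field_simps)
        with n show False by simp
      qed
    qed
    then show ?thesis by (simp add: f_def)
  qed
  then show ?thesis using that[of K] K by simp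
qed

section \<open>Orthogonal projection, Riesz representation and adjoints\<close>

lemma norm_add_squared:
  "(norm (x + y))\<^sup>2 = (norm x)\<^sup>2 + (norm y)\<^sup>2 + 2 * Re (cinner x (y::'a::complex_inner))"
proof -
  have "complex_of_real ((norm (x + y))\<^sup>2)
      = complex_of_real ((norm x)\<^sup>2) + complex_of_real ((norm y)\<^sup>2) + (cinner x y + cnj (cinner x y))"
    unfolding cinner_self[symmetric]
    using cinner_commute[of y x] by (simp add: cinner_simps)
  also have "\<dots> = complex_of_real ((norm x)\<^sup>2 + (norm y)\<^sup>2 + 2 * Re (cinner x y))"
    by (simp add: complex_add_cnj)
  finally show ?thesis
    using of_real_eq_iff by blast
qed

lemma norm_diff_squared:
  "(norm (x - y))\<^sup>2 = (norm x)\<^sup>2 + (norm y)\<^sup>2 - 2 * Re (cinner x (y::'a::complex_inner))"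
  using norm_add_squared[of x "- y"] by (simp add: cinner_minus_right)

text \<open>First-order variation: moving \<open>u\<close> a small step along its component in
  direction \<open>z\<close> would shorten it unless that component is zero.\<close>

lemma norm_le_imp_orthogonal:
  assumes min: "\<And>s. norm (u::'a::complex_inner) \<le> norm (u - s *\<^sub>C z)"
  shows "cinner u z = 0"
proof -
  define b where "b = cinner u z"
  \<comment> \<open>This step size gives \<open>t * (norm z)\<^sup>2 \<le> 1\<close>, so the
    quadratic term is at most half the linear gain; the added 1 covers \<open>z = 0\<close>.\<close>
  define t where "t = 1 / ((norm z)\<^sup>2 + 1)"
  have d: "0 < (norm z)\<^sup>2 + 1" by (simp add: add_nonneg_pos)
  have t: "0 < t" using d by (simp add: t_def)
  have "(norm u)\<^sup>2 \<le> (norm (u - (t * b) *\<^sub>C z))\<^sup>2"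
    by (intro power_mono min) simp
  also have "\<dots> = (norm u)\<^sup>2 + t\<^sup>2 * (cmod b)\<^sup>2 * (norm z)\<^sup>2 - 2 * (t * (cmod b)\<^sup>2)"
    using complex_norm_square[of b]
    by (simp add: norm_diff_squared norm_scaleC cinner_simps b_def[symmetric] norm_mult
        power_mult_distrib complex_eq_iff cmod_power2 power2_eq_square[symmetric] algebra_simps)
  finally have "t * (2 * (cmod b)\<^sup>2) \<le> t * (t * (norm z)\<^sup>2 * (cmod b)\<^sup>2)"
    by (simp add: power2_eq_square algebra_simps)
  then have "2 * (cmod b)\<^sup>2 \<le> (t * (norm z)\<^sup>2) * (cmod b)\<^sup>2"
    using t by simp
  also have "\<dots> \<le> 1 * (cmod b)\<^sup>2"
    using d by (intro mult_right_mono) (auto simp: t_def field_simps)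
  finally have "b = 0" by simp
  then show ?thesis by (simp add: b_def)
qed

text \<open>A minimizing sequence for the distance from \<open>x\<close> to \<open>M\<close> is
  Cauchy by the parallelogram law. Its limit attains the distance, and minimality gives
  orthogonality.\<close>

lemma closed_subspace_projection:
  fixes M :: "'a::chilbert_space set"
  assumes closed: "closed M" and "0 \<in> M"
    and add: "\<And>x y. x \<in> M \<Longrightarrow> y \<in> M \<Longrightarrow> x + y \<in> M"
    and scale: "\<And>c x. x \<in> M \<Longrightarrow> c *\<^sub>C x \<in> M"
  shows "\<exists>m\<in>M. \<forall>z\<in>M. cinner (x - m) z = 0"
proof -
  define D where "D = (\<lambda>m. (norm (x - m))\<^sup>2) ` M"
  define d where "d = Inf D"
  have D: "D \<noteq> {}" "bdd_below D"
    using \<open>0 \<in> M\<close> by (auto simp: D_def intro: bdd_belowI[of _ 0])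
  have d: "d \<le> (norm (x - m))\<^sup>2" if "m \<in> M" for m
    unfolding d_def using D that by (intro cInf_lower) (auto simp: D_def)
  have "\<exists>m\<in>M. (norm (x - m))\<^sup>2 < d + 1 / real (Suc n)" for n
  proof -
    have "Inf D < d + 1 / real (Suc n)" by (simp add: d_def)
    from cInf_lessD[OF D(1) this] show ?thesis by (auto simp: D_def)
  qed
  then obtain m where m: "\<And>n. m n \<in> M" "\<And>n. (norm (x - m n))\<^sup>2 < d + 1 / real (Suc n)"
    by metis
  \<comment> \<open>The midpoint of \<open>m i\<close> and \<open>m j\<close> lies in
    \<open>M\<close>, so its squared distance from \<open>x\<close> is at least \<open>d\<close>; in
    the parallelogram law the terms \<open>4 * d\<close> cancel.\<close>
  have close: "(norm (m i - m j))\<^sup>2 \<le> 2 / real (Suc i) + 2 / real (Suc j)" for i j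
  proof -
    define u v where "u = x - m i" and "v = x - m j"
    have "(1/2) *\<^sub>R (m i + m j) \<in> M"
      unfolding scaleR_scaleC by (intro scale add m)
    then have "d \<le> (norm (x - (1/2) *\<^sub>R (m i + m j)))\<^sup>2" by (rule d)
    also have "x - (1/2) *\<^sub>R (m i + m j) = (1/2) *\<^sub>R (u + v)"
      by (simp add: u_def v_def algebra_simps flip: scaleR_add_left)
    finally have "4 * d \<le> (norm (u + v))\<^sup>2" by (simp add: power_divide)
    moreover have "(norm (u + v))\<^sup>2 + (norm (u - v))\<^sup>2 = 2 * (norm u)\<^sup>2 + 2 * (norm v)\<^sup>2"
      by (simp add: norm_add_squared norm_diff_squared)
    moreover have "norm (u - v) = norm (m i - m j)"
      by (simp add: u_def v_def norm_minus_commute)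
    ultimately show ?thesis
      using m(2)[of i] m(2)[of j] by (simp add: u_def v_def)
  qed
  have "Cauchy m"
  proof (rule metric_CauchyI)
    fix e :: real assume e: "0 < e"
    obtain N where N: "4 / e\<^sup>2 < real N" using reals_Archimedean2 by blast
    show "\<exists>N. \<forall>i\<ge>N. \<forall>j\<ge>N. dist (m i) (m j) < e"
    proof (intro exI allI impI)
      fix i j assume ij: "N \<le> i" "N \<le> j"
      have N0: "0 < real N" using N e by (smt (verit) divide_pos_pos zero_less_power)
      have "(norm (m i - m j))\<^sup>2 \<le> 2 / real (Suc i) + 2 / real (Suc j)" by (rule close)
      also have "\<dots> \<le> 2 / real N + 2 / real N"
        using ij N0 by (intro add_mono divide_left_mono) auto
      also have "\<dots> < e\<^sup>2" using N N0 e by (simp add: field_simps)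
      finally show "dist (m i) (m j) < e"
        using e by (simp add: dist_norm power_less_imp_less_base)
    qed
  qed
  then obtain l where l: "m \<longlonglongrightarrow> l" using Cauchy_convergent convergentD by blast
  have lM: "l \<in> M" using closed_sequentially[OF closed _ l] m by blast
  have "(\<lambda>n. (norm (x - m n))\<^sup>2) \<longlonglongrightarrow> (norm (x - l))\<^sup>2"
    by (intro tendsto_intros l)
  moreover have "(\<lambda>n. d + 1 / real (Suc n)) \<longlonglongrightarrow> d"
    using tendsto_add[OF tendsto_const LIMSEQ_inverse_real_of_nat] by (simp add: inverse_eq_divide)
  ultimately have "(norm (x - l))\<^sup>2 \<le> d"
    using m(2) by (intro LIMSEQ_le) (auto intro: less_imp_le)
  then have min: "norm (x - l) \<le> norm (x - k)" if "k \<in> M" for k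
    using d[OF that] by (meson norm_ge_zero order_trans power2_le_imp_le)
  have "cinner (x - l) z = 0" if "z \<in> M" for z
  proof (rule norm_le_imp_orthogonal)
    show "norm (x - l) \<le> norm (x - l - s *\<^sub>C z)" for s
      using min[of "l + s *\<^sub>C z"] add[OF lM scale[OF that]] by (simp add: diff_diff_eq)
  qed
  with lM show ?thesis by blast
qed

text \<open>The kernel of a nonzero functional has a nonzero normal vector \<open>u\<close>, and
  every \<open>x\<close> differs from a multiple of \<open>u\<close> by a kernel element.\<close>

lemma Riesz_representation:
  fixes f :: "'a::chilbert_space \<Rightarrow> complex"
  assumes f: "bounded_linear f" and homogeneous: "\<And>c x. f (c *\<^sub>C x) = c * f x"
  obtains y where "\<And>x. f x = cinner x y"
proof (cases "\<forall>x. f x = 0")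
  case True
  then show ?thesis using that[of 0] by simp
next
  case False
  interpret bounded_linear f by (rule f)
  obtain a where a: "f a \<noteq> 0" using False by blast
  define M where "M = {x. f x = 0}"
  have "closed M"
    unfolding M_def by (intro closed_Collect_eq continuous_intros linear_continuous_on f)
  then have "\<exists>m\<in>M. \<forall>z\<in>M. cinner (a - m) z = 0"
    by (rule closed_subspace_projection) (auto simp: M_def zero add homogeneous)
  then obtain m where m: "m \<in> M" "\<And>z. z \<in> M \<Longrightarrow> cinner (a - m) z = 0"
    by blast
  define u where "u = a - m"
  have fu: "f u \<noteq> 0" using a m(1) by (simp add: u_def diff M_def)
  then have u: "cinner u u \<noteq> 0" using cinner_self_eq_zero_iff[of u] zero by auto
  \<comment> \<open>The coefficient is conjugated because the inner product is antilinear in its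
    second argument.\<close>
  have "f x = cinner x (cnj (f u / cinner u u) *\<^sub>C u)" for x
  proof -
    have "x - (f x / f u) *\<^sub>C u \<in> M" using fu by (simp add: M_def diff homogeneous)
    then have "cinner u (x - (f x / f u) *\<^sub>C u) = 0" using m(2) by (simp add: u_def)
    then have "cinner (x - (f x / f u) *\<^sub>C u) u = 0" by (metis cinner_commute complex_cnj_zero)
    then have "cinner x u = f x / f u * cinner u u" by (simp add: cinner_simps)
    then show ?thesis using fu u by (simp add: cinner_simps)
  qed
  then show ?thesis using that by blast
qed

text \<open>Justifies the description in \<open>cadjoint\<close>. Riesz applied to
  \<open>\<lambda>x. cinner (T x) y\<close> supplies \<open>S y\<close> for each \<open>y\<close>;
  nondegeneracy gives linearity and uniqueness.\<close>

lemma cadjoint_exists: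
  fixes T :: "'a::chilbert_space \<Rightarrow> 'a"
  assumes T: "bounded_clinear T"
  shows "\<exists>!S. bounded_clinear S \<and> (\<forall>x y. cinner (T x) y = cinner x (S y))"
proof -
  note T_simps = bounded_clinear_linear[OF T]
  obtain K where K: "0 \<le> K" "\<And>x. norm (T x) \<le> norm x * K"
    using bounded_linear.nonneg_bounded[OF T_simps(1)] by blast
  have "\<exists>z. \<forall>x. cinner (T x) y = cinner x z" for y
  proof -
    have "bounded_linear (\<lambda>x. cinner (T x) y)"
    proof (rule bounded_linear_intro)
      show "norm (cinner (T x) y) \<le> norm x * (K * norm y)" for x
        using norm_cinner_le[of "T x" y] mult_right_mono[OF K(2)[of x], of "norm y"]
        by (simp add: ac_simps)
    qed (simp_all add: T_simps cinner_simps scaleR_scaleC scaleC_complex_def)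
    then show ?thesis
      using Riesz_representation[of "\<lambda>x. cinner (T x) y"] by (metis T_simps(2) cinner_scaleC_left)
  qed
  then obtain S where S: "\<And>x y. cinner (T x) y = cinner x (S y)" by metis
  have "bounded_clinear S"
  proof (rule bounded_clinearI)
    show "S (x + y) = S x + S y" for x y
      by (rule cinner_right_eqI) (simp add: cinner_simps S[symmetric])
    show "S (c *\<^sub>C x) = c *\<^sub>C S x" for c x
      by (rule cinner_right_eqI) (simp add: cinner_simps S[symmetric])
    show "norm (S x) \<le> norm x * K" for x
    proof -
      have "(norm (S x))\<^sup>2 = cmod (cinner (T (S x)) x)"
        by (simp add: S cinner_self del: of_real_power)
      also have "\<dots> \<le> norm (S x) * K * norm x"
        using norm_cinner_le[of "T (S x)" x] mult_right_mono[OF K(2)[of "S x"], of "norm x"] by simp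
      finally have "norm (S x) * norm (S x) \<le> norm (S x) * (norm x * K)"
        by (simp add: power2_eq_square ac_simps)
      then show ?thesis
        by (cases "S x = 0") (simp_all add: K)
    qed
  qed
  moreover have "S' = S" if "\<forall>x y. cinner (T x) y = cinner x (S' y)" for S'
    by (rule ext, rule cinner_right_eqI) (simp add: that[rule_format, symmetric] S[symmetric])
  ultimately show ?thesis using S by blast
qed

lemma cadjoint:
  assumes "bounded_clinear T"
  shows "cinner (T x) y = cinner x (cadjoint T y)"
  using theI'[OF cadjoint_exists[OF assms]] unfolding cadjoint_def by blast

lemma cadjoint_scaleC:
  assumes T: "bounded_clinear T"
  shows "cadjoint (\<lambda>x. c *\<^sub>C T x) y = cnj c *\<^sub>C cadjoint T y"
  by (rule cinner_right_eqI)
    (simp add: cinner_simps cadjoint[OF T, symmetric] cadjoint[OF bounded_clinear_scaleC[OF T], symmetric])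

section \<open>The reduced solution\<close>

context
  fixes A :: "'a::chilbert_space \<Rightarrow> 'a"
  assumes A: "positive_op A"
begin

lemmas A_lin = bounded_clinear_linear[OF positive_op_bounded_clinear[OF A]]

lemma closure_range_add:
  assumes "x \<in> closure (range A)" "y \<in> closure (range A)"
  shows "x + y \<in> closure (range A)"
proof -
  obtain f where "\<forall>n. f n \<in> range A" "f \<longlonglongrightarrow> x"
    using assms(1) unfolding closure_sequential by blast
  moreover obtain g where "\<forall>n. g n \<in> range A" "g \<longlonglongrightarrow> y"
    using assms(2) unfolding closure_sequential by blast
  moreover have "u + v \<in> range A" if "u \<in> range A" "v \<in> range A" for u v
    using that by (auto simp: A_lin(3)[symmetric])
  ultimately show ?thesis
    unfolding closure_sequential by (intro exI[of _ "\<lambda>n. f n + g n"]) (auto intro: tendsto_add)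
qed

lemma closure_range_scaleC:
  assumes "x \<in> closure (range A)"
  shows "c *\<^sub>C x \<in> closure (range A)"
proof -
  have "bounded_clinear (\<lambda>x::'a. c *\<^sub>C x)"
    using bounded_clinear_scaleC[OF positive_op_bounded_clinear[OF positive_op_id]] by simp
  then have "(\<lambda>x. c *\<^sub>C x) ` closure (range A) \<subseteq> closure ((\<lambda>x. c *\<^sub>C x) ` range A)"
    by (intro closure_bounded_linear_image_subset bounded_clinear_linear(1))
  also have "\<dots> \<subseteq> closure (range A)"
    by (intro closure_mono) (auto simp: A_lin(2)[symmetric])
  finally show ?thesis using assms by blast
qed

lemma kernel_orthogonal_closure_range:
  assumes n: "A n = 0" and x: "x \<in> closure (range A)"
  shows "cinner n x = 0"
proof -
  obtain f where f: "\<And>k. f k \<in> range A" "f \<longlonglongrightarrow> x"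
    using x unfolding closure_sequential by blast
  have z: "cinner n (f k) = 0" for k
    using f(1)[of k] n by (auto simp: positive_op_symmetric[OF A, symmetric])
  \<comment> \<open>The map is antilinear over the complex numbers, but real linearity is enough for
    continuity.\<close>
  have "bounded_linear (\<lambda>y. cinner n y)"
  proof (rule bounded_linear_intro)
    show "norm (cinner n y) \<le> norm y * norm n" for y
      using norm_cinner_le[of n y] by (simp add: mult.commute)
  qed (simp_all add: cinner_simps scaleR_scaleC scaleC_complex_def)
  from bounded_linear.tendsto[OF this f(2)] show ?thesis
    by (simp add: z LIMSEQ_const_iff)
qed

text \<open>The difference \<open>x - y\<close> lies both in the kernel of \<open>A\<close> and in
  the closure of its range, hence is orthogonal to itself.\<close>

lemma inj_on_closure_range:
  assumes "x \<in> closure (range A)" "y \<in> closure (range A)" "A x = A y"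
  shows "x = y"
proof -
  have "x + (-1) *\<^sub>C y \<in> closure (range A)"
    using assms by (intro closure_range_add closure_range_scaleC)
  moreover have "A (x - y) = 0" using assms by (simp add: A_lin)
  ultimately have "cinner (x - y) (x - y) = 0"
    using kernel_orthogonal_closure_range by (simp add: scaleC_minus_one)
  then show ?thesis using cinner_self_eq_zero_iff[of "x - y"] by simp
qed

text \<open>\<open>P\<close> is the orthogonal projection onto the closure of the range. Since
  \<open>A\<close> is injective there, \<open>A (P x) = A x\<close> determines \<open>P\<close>, and
  its linearity follows from that of \<open>A\<close>.\<close>

lemma range_projection:
  obtains P where "bounded_clinear P" "range P \<subseteq> closure (range A)" "\<And>x. A (P x) = A x"
proof -
  have "\<exists>m. m \<in> closure (range A) \<and> A m = A x" for x
  proof -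
    have "0 \<in> range A" using A_lin(5) by (metis rangeI)
    then have z: "0 \<in> closure (range A)" by (rule subsetD[OF closure_subset])
    obtain m where m: "m \<in> closure (range A)" "\<And>z. z \<in> closure (range A) \<Longrightarrow> cinner (x - m) z = 0"
      using closed_subspace_projection[of "closure (range A)" x] z
        closure_range_add closure_range_scaleC by blast
    have "A (x - m) = 0"
    proof (rule cinner_left_eqI)
      fix z
      have "A z \<in> closure (range A)" by (rule subsetD[OF closure_subset]) simp
      then show "cinner (A (x - m)) z = cinner 0 z"
        using m(2) by (simp add: positive_op_symmetric[OF A])
    qed
    with m(1) show ?thesis by (auto simp: A_lin)
  qed
  then obtain P where P: "\<And>x. P x \<in> closure (range A)" "\<And>x. A (P x) = A x" by metis
  have "bounded_clinear P"
  proof (rule bounded_clinearI)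
    show "P (x + y) = P x + P y" for x y
      by (rule inj_on_closure_range) (auto simp: P A_lin closure_range_add)
    show "P (c *\<^sub>C x) = c *\<^sub>C P x" for c x
      by (rule inj_on_closure_range) (auto simp: P A_lin closure_range_scaleC)
    show "norm (P x) \<le> norm x * 1" for x
    proof -
      have "cinner (x - P x) (P x) = 0"
        by (rule kernel_orthogonal_closure_range) (simp_all add: P A_lin)
      then have "(norm x)\<^sup>2 = (norm (x - P x))\<^sup>2 + (norm (P x))\<^sup>2"
        using norm_add_squared[of "x - P x" "P x"] by simp
      then have "(norm (P x))\<^sup>2 \<le> (norm x)\<^sup>2" by simp
      then show ?thesis by (simp add: power2_le_iff_abs_le)
    qed
  qed
  with P show ?thesis using that[of P] by blast
qed

text \<open>Projecting any \<open>A\<close>-adjoint \<open>R\<close> onto the closure of the range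
  keeps \<open>A \<circ> R\<close> unchanged and gives the reduced solution; injectivity of
  \<open>A\<close> there makes it unique.\<close>

lemma sharp_A:
  assumes T: "T \<in> B_A A"
  shows "bounded_clinear (sharp_A A T)" "A (sharp_A A T x) = cadjoint T (A x)"
proof -
  obtain R where R: "bounded_clinear R" "A \<circ> R = cadjoint T \<circ> A"
    using T by (auto simp: B_A_def)
  obtain P where P: "bounded_clinear P" "range P \<subseteq> closure (range A)" "\<And>x. A (P x) = A x"
    using range_projection by blast
  let ?Q = "\<lambda>X. bounded_clinear X \<and> A \<circ> X = cadjoint T \<circ> A \<and> range X \<subseteq> closure (range A)"
  have ex: "?Q (P \<circ> R)"
    using bounded_clinear_compose[OF P(1) R(1)] P R(2) by (auto simp: fun_eq_iff)
  have uniq: "X = P \<circ> R" if "?Q X" for X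
  proof
    fix x
    show "X x = (P \<circ> R) x"
      by (rule inj_on_closure_range) (use that ex in \<open>auto simp: fun_eq_iff\<close>)
  qed
  have "?Q (sharp_A A T)"
    unfolding sharp_A_def using theI[of ?Q, OF ex uniq] .
  then show "bounded_clinear (sharp_A A T)" "A (sharp_A A T x) = cadjoint T (A x)"
    by (auto simp: fun_eq_iff)
qed

lemma B_A_scaleC:
  assumes "T \<in> B_A A"
  shows "(\<lambda>x. c *\<^sub>C T x) \<in> B_A A"
proof -
  obtain R where T: "bounded_clinear T" and R: "bounded_clinear R" "A \<circ> R = cadjoint T \<circ> A"
    using assms by (auto simp: B_A_def)
  have "A \<circ> (\<lambda>x. cnj c *\<^sub>C R x) = cadjoint (\<lambda>x. c *\<^sub>C T x) \<circ> A"
    using R(2) by (auto simp: fun_eq_iff A_lin cadjoint_scaleC[OF T])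
  with T R(1) show ?thesis
    unfolding B_A_def using bounded_clinear_scaleC by blast
qed

section \<open>The \<open>A\<close>-adjoint and the \<open>A\<close>-real part with respect to the
  form\<close>

lemma inner_sharp_A:
  assumes T: "T \<in> B_A A"
  shows "cinner (A (sharp_A A T x)) y = cinner (A x) (T y)"
proof -
  have b: "bounded_clinear T" using T by (simp add: B_A_def)
  show ?thesis
    using cadjoint[OF b, of y "A x"] by (metis sharp_A(2)[OF T] cinner_commute)
qed

lemma inner_sharp_A':
  assumes T: "T \<in> B_A A"
  shows "cinner (A (T x)) y = cinner (A x) (sharp_A A T y)"
  using inner_sharp_A[OF T, of y x]
  by (metis cinner_commute positive_op_symmetric[OF A])

lemma bounded_clinear_Re_A:
  assumes "T \<in> B_A A"
  shows "bounded_clinear (Re_A A T)"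
  unfolding Re_A_def using assms
  by (intro bounded_clinear_scaleC bounded_clinear_add sharp_A(1)) (auto simp: B_A_def)

lemma Re_A_symmetric:
  assumes T: "T \<in> B_A A"
  shows "cinner (A (Re_A A T x)) y = cinner (A x) (Re_A A T y)"
  by (simp add: Re_A_def A_lin cinner_simps inner_sharp_A[OF T] inner_sharp_A'[OF T])

lemma inner_Re_A:
  assumes T: "T \<in> B_A A"
  shows "cinner (A (Re_A A T x)) x = complex_of_real (Re (cinner (A (T x)) x))"
proof -
  have "cinner (A x) (T x) = cnj (cinner (A (T x)) x)"
    by (metis cinner_commute positive_op_symmetric[OF A])
  then show ?thesis
    by (simp add: Re_A_def A_lin cinner_simps inner_sharp_A[OF T] complex_add_cnj)
qed

text \<open>The supremum in \<open>opnorm_A\<close> ranges over the closure of the range only, so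
  \<open>x\<close> is replaced by its projection \<open>P x\<close>. Symmetry of \<open>H\<close>
  provides both the finiteness of the supremum and the invariance under this replacement.\<close>

lemma seminorm_le_opnorm_A:
  assumes H: "bounded_clinear H"
    and sym: "\<And>x y. cinner (A (H x)) y = cinner (A x) (H y)"
    and x: "seminorm_A A x = 1"
  shows "seminorm_A A (H x) \<le> opnorm_A A H"
proof -
  let ?S = "{seminorm_A A (H x) / seminorm_A A x | x. x \<in> closure (range A) \<and> x \<noteq> 0}"
  obtain K where K: "0 \<le> K" "\<And>x. seminorm_A A (H x) \<le> K * seminorm_A A x"
    using A_symmetric_bounded[OF A bounded_clinear_linear(1)[OF H] sym] by blast
  have "seminorm_A A (H y) / seminorm_A A y \<le> K" for y
    using K(1) K(2)[of y] seminorm_A_nonneg[OF A, of y]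
    by (cases "seminorm_A A y = 0") (auto simp: divide_le_eq)
  then have bdd: "bdd_above (insert 0 ?S)"
    using K(1) by (intro bdd_aboveI[of _ K]) auto
  obtain P where "bounded_clinear P" and P: "range P \<subseteq> closure (range A)" "\<And>x. A (P x) = A x"
    using range_projection by blast
  \<comment> \<open>Symmetry shifts \<open>H\<close> to the other argument, where only
    \<open>A (P x) = A x\<close> is seen.\<close>
  have AH: "A (H (P x)) = A (H x)"
    by (rule cinner_left_eqI) (simp add: sym P)
  \<comment> \<open>The semi-norm of a vector depends only on its image under
    \<open>A\<close>.\<close>
  have cong: "seminorm_A A u = seminorm_A A v" if "A u = A v" for u v
    using that positive_op_symmetric[OF A, of u v] positive_op_symmetric[OF A, of v v]
    by (simp add: seminorm_A_def inner_A_def) (metis positive_op_symmetric[OF A])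
  have "seminorm_A A (P x) = 1" using cong[OF P(2)] x by simp
  moreover from this have "P x \<noteq> 0"
    by (auto simp: seminorm_A_def inner_A_def)
  ultimately have "seminorm_A A (H (P x)) \<in> insert 0 ?S"
    using P(1) by (auto intro!: exI[of _ "P x"])
  then have "seminorm_A A (H (P x)) \<le> opnorm_A A H"
    unfolding opnorm_A_def by (rule cSup_upper[OF _ bdd])
  then show ?thesis using cong[OF AH] by simp
qed

lemma Re_inner_le_opnorm_Re_A:
  assumes T: "T \<in> B_A A" and x: "seminorm_A A x = 1"
  shows "\<bar>Re (cinner (A (T x)) x)\<bar> \<le> opnorm_A A (Re_A A T)"
proof -
  have "\<bar>Re (cinner (A (T x)) x)\<bar> = cmod (cinner (A (Re_A A T x)) x)"
    by (simp add: inner_Re_A[OF T])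
  also have "\<dots> \<le> seminorm_A A (Re_A A T x)"
    using inner_A_le_seminorm[OF A, of "Re_A A T x" x] x by simp
  also have "\<dots> \<le> opnorm_A A (Re_A A T)"
    by (rule seminorm_le_opnorm_A[OF bounded_clinear_Re_A[OF T] Re_A_symmetric[OF T] x])
  finally show ?thesis .
qed

end

theorem theorem3:
  fixes A T :: "'a::chilbert_space \<Rightarrow> 'a" and \<phi> :: real
  assumes "\<exists>x::'a. x \<noteq> 0"
    and "positive_op A"
    and "T \<in> B_A A"
    and "\<phi> \<in> {0..<2 * pi}"
  shows "(numrad_A A T)\<^sup>2 \<le> (opnorm_A A (H_A A T \<phi>))\<^sup>2 + (opnorm_A A (H_A A T (\<phi> + pi / 2)))\<^sup>2"
proof -
  note A = assms(2)
  define B where "B = (opnorm_A A (H_A A T \<phi>))\<^sup>2 + (opnorm_A A (H_A A T (\<phi> + pi / 2)))\<^sup>2"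
  let ?N = "insert 0 {cmod (inner_A A (T x) x) | x. seminorm_A A x = 1}"
  have "cmod (inner_A A (T x) x) \<le> sqrt B" if x: "seminorm_A A x = 1" for x
  proof (rule real_le_rsqrt)
    \<comment> \<open>The rotation leaves the modulus unchanged, so it is enough to bound the real
      and imaginary parts of \<open>w\<close>.\<close>
    define w where "w = exp (\<i> * complex_of_real \<phi>) * inner_A A (T x) x"
    have bound: "\<bar>Re (exp (\<i> * complex_of_real \<psi>) * inner_A A (T x) x)\<bar> \<le> opnorm_A A (H_A A T \<psi>)" for \<psi>
      using Re_inner_le_opnorm_Re_A[OF A B_A_scaleC[OF A assms(3)] x]
      by (simp add: H_A_def inner_A_def A_lin[OF A] cinner_simps)
    \<comment> \<open>The extra quarter turn multiplies by \<open>\<i>\<close>, and the real part of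
      \<open>\<i> * w\<close> is \<open>- Im w\<close>.\<close>
    have "exp (\<i> * complex_of_real (\<phi> + pi / 2)) * inner_A A (T x) x = \<i> * w"
      unfolding w_def cis_conv_exp[symmetric] cis_mult[symmetric] by simp
    then have "\<bar>Im w\<bar> \<le> opnorm_A A (H_A A T (\<phi> + pi / 2))"
      using bound[of "\<phi> + pi / 2"] by simp
    moreover have "\<bar>Re w\<bar> \<le> opnorm_A A (H_A A T \<phi>)"
      using bound[of \<phi>] by (simp add: w_def)
    moreover have "cmod (inner_A A (T x) x) = cmod w"
      by (simp add: w_def norm_mult)
    ultimately show "(cmod (inner_A A (T x) x))\<^sup>2 \<le> B"
      unfolding B_def by (auto simp: cmod_power2 intro!: add_mono abs_le_square_iff[THEN iffD1])
  qed
  moreover have B: "0 \<le> B" by (simp add: B_def)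
  ultimately have N: "z \<le> sqrt B" if "z \<in> ?N" for z
    using that by auto
  then have "numrad_A A T \<le> sqrt B"
    unfolding numrad_A_def by (intro cSup_least) auto
  \<comment> \<open>Needed for squaring the inequality; the inserted 0 lies below the supremum
    because the set is bounded above.\<close>
  moreover have "0 \<le> numrad_A A T"
  proof -
    have "bdd_above ?N" using N by (rule bdd_aboveI)
    then show ?thesis unfolding numrad_A_def by (rule cSup_upper[rotated]) simp
  qed
  ultimately have "(numrad_A A T)\<^sup>2 \<le> (sqrt B)\<^sup>2"
    by (intro power_mono)
  then show ?thesis using B by (simp add: B_def)
qed

end
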